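(* For integers $b\geq a\geq 1$ with $a+b=n-8$, $E_{\mathcal{E}}(T_{n,7}^{a,b})>E_{\mathcal{E}}(T_{n,3}^{0,n-4})$.
   Context: For a connected graph $G$, the eccentricity matrix $\mathcal{E}(G)$ is the matrix indexed by $V(G)$ with $(u,v)$-entry $d_G(u,v)$ if $d_G(u,v)=\min\{e_G(u),e_G(v)\}$ and $0$ otherwise, where $d_G$ is the distance and $e_G(u)=\max_v d_G(u,v)$ the eccentricity. The $\mathcal{E}$-energy $E_{\mathcal{E}}(G)$ is the sum of absolute values of the eigenvalues of $\mathcal{E}(G)$. For odd $d\geq 3$ and $b\geq a\geq 0$ with $a+b=n-d-1$, $T_{n,d}^{a,b}$ is the tree obtained from the path $v_0v_1\cdots v_d$ by attaching $a$ pendant vertices to $v_{(d-1)/2}$ and $b$ pendant vertices to $v_{(d+1)/2}$. *)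

theory Defs
  imports
    "Graph_Theory.Digraph_Component"
    "Graph_Theory.Pair_Digraph"
    "Graph_Theory.Shortest_Path"
    "Jordan_Normal_Form.Char_Poly"
    "HOL-Computational_Algebra.Fundamental_Theorem_Algebra"
begin

text \<open>
  Finite simple graphs are the \<^locale>\<open>pair_graph\<close>s: every edge is represented by
  its two opposite arcs.
\<close>

text \<open>
  Every arc has weight 1, so this is the least number of edges on a walk. In a connected graph
  the infimum is finite, and the conversion from \<^typ>\<open>ereal\<close> loses nothing.
\<close>

definition graph_dist :: "'a pair_pre_digraph \<Rightarrow> 'a \<Rightarrow> 'a \<Rightarrow> real" where
  "graph_dist G u v = real_of_ereal (wf_digraph.\<mu> (with_proj G) (\<lambda>_. 1) u v)"

definition eccentricity :: "'a pair_pre_digraph \<Rightarrow> 'a \<Rightarrow> real" where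
  "eccentricity G u = Max ((\<lambda>v. graph_dist G u v) ` pverts G)"

definition ecc_entry :: "'a pair_pre_digraph \<Rightarrow> 'a \<Rightarrow> 'a \<Rightarrow> real" where
  "ecc_entry G u v =
     (if graph_dist G u v = min (eccentricity G u) (eccentricity G v)
      then graph_dist G u v else 0)"

text \<open>
  Matrices are indexed by \<open>0, \<dots>, n - 1\<close>; row and column \<open>i\<close> belong to the
  \<open>i\<close>-th smallest vertex.
\<close>

definition ecc_matrix :: "'a::linorder pair_pre_digraph \<Rightarrow> real mat" where
  "ecc_matrix G =
     (let vs = sorted_list_of_set (pverts G); n = length vs
      in mat n n (\<lambda>(i, j). ecc_entry G (vs ! i) (vs ! j)))"

text \<open>
  \<^const>\<open>proots\<close> is the multiset of roots, so the eigenvalues count with multiplicity.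
\<close>

definition ecc_energy :: "'a::linorder pair_pre_digraph \<Rightarrow> real" where
  "ecc_energy G =
     (\<Sum>x\<in>#proots (char_poly (map_mat complex_of_real (ecc_matrix G))). cmod x)"

text \<open>
  The tree \<open>T\<^bsub>n,d\<^esub>\<^bsup>a,b\<^esup>\<close>, whose order \<open>n = d + 1 + a + b\<close> is determined by
  \<open>d\<close>, \<open>a\<close> and \<open>b\<close>. The vertices \<open>0, \<dots>, d\<close> form the path, the next
  \<open>a\<close> vertices are pendant at \<open>(d - 1) / 2\<close> and the last \<open>b\<close> vertices are
  pendant at \<open>(d + 1) / 2\<close>.
\<close>

definition tree_T :: "nat \<Rightarrow> nat \<Rightarrow> nat \<Rightarrow> nat pair_pre_digraph" where
  "tree_T d a b =
     (let E = {(i, i + 1) | i. i < d}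
            \<union> {((d - 1) div 2, j) | j. d < j \<and> j \<le> d + a}
            \<union> {((d + 1) div 2, j) | j. d + a < j \<and> j \<le> d + a + b}
      in \<lparr> pverts = {..<d + 1 + a + b}, parcs = E \<union> E\<inverse> \<rparr>)"

lemma pair_graph_tree_T:
  assumes "d \<ge> 1"
  shows "pair_graph (tree_T d a b)"
proof -
  have wf: "u < d + 1 + a + b \<and> v < d + 1 + a + b \<and> u \<noteq> v \<and> (v, u) \<in> parcs (tree_T d a b)"
    if "(u, v) \<in> parcs (tree_T d a b)" for u v
    using that assms by (auto simp: tree_T_def Let_def)
  have V: "pverts (tree_T d a b) = {..<d + 1 + a + b}"
    by (simp add: tree_T_def Let_def)
  have "parcs (tree_T d a b) \<subseteq> {..<d + 1 + a + b} \<times> {..<d + 1 + a + b}"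
    using wf by auto
  then have "finite (parcs (tree_T d a b))"
    by (rule finite_subset) simp
  then show ?thesis
    using wf V by unfold_locales (auto simp: symmetric_def sym_def)
qed

lemma connected_tree_T:
  assumes "d \<ge> 1"
  shows "strongly_connected (with_proj (tree_T d a b))"
proof -
  let ?G = "with_proj (tree_T d a b)"
  interpret pair_graph "tree_T d a b"
    using assms by (rule pair_graph_tree_T)
  have path: "0 \<rightarrow>\<^sup>*\<^bsub>?G\<^esub> i" if "i \<le> d" for i
    using that
  proof (induction i)
    case 0
    show ?case by (rule reachable_refl) (simp add: tree_T_def Let_def)
  next
    case (Suc i)
    have "(i, Suc i) \<in> parcs (tree_T d a b)"
      using Suc.prems by (auto simp: tree_T_def Let_def)
    then show ?case using Suc reachable_adj_trans by auto
  qed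
  have root: "0 \<rightarrow>\<^sup>*\<^bsub>?G\<^esub> v" if v: "v < d + 1 + a + b" for v
  proof (cases "v \<le> d")
    case False
    define c where "c = (if v \<le> d + a then (d - 1) div 2 else (d + 1) div 2)"
    have "(c, v) \<in> parcs (tree_T d a b)"
      using False v by (auto simp: tree_T_def Let_def c_def)
    moreover have "c \<le> d" using assms by (auto simp: c_def)
    ultimately show ?thesis using path reachable_adj_trans by auto
  qed (rule path)
  have V: "pverts (tree_T d a b) = {..<d + 1 + a + b}"
    by (simp add: tree_T_def Let_def)
  have "u \<rightarrow>\<^sup>*\<^bsub>?G\<^esub> v" if "u < d + 1 + a + b" and "v < d + 1 + a + b" for u v
    using symmetric_reachable[OF pair_sym_arcs root[OF that(1)]] root[OF that(2)]
    by (rule reachable_trans)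
  then show ?thesis
    unfolding strongly_connected_def with_proj_simps V by (simp add: lessThan_empty_iff)
qed

end

theory Submission
  imports Defs
begin

text \<open>
  In \<open>T\<^bsub>n,7\<^esub>\<^bsup>a,b\<^esup>\<close> every nonzero entry of the eccentricity matrix lies in the row or column of an
  end \<open>v\<^sub>0\<close>, \<open>v\<^sub>7\<close> of the path; in \<open>T\<^bsub>n,3\<^esub>\<^bsup>0,n-4\<^esup>\<close> the vertices \<open>v\<^sub>0\<close>, \<open>v\<^sub>1\<close> play this role. Both matrices
  therefore have the form \<open>e\<^sub>i u\<^sup>T + u e\<^sub>i\<^sup>T + e\<^sub>j w\<^sup>T + w e\<^sub>j\<^sup>T\<close>, of rank at most 4, and comparing the
  characteristic polynomials of \<open>A * B\<close> and \<open>B * A\<close> shows that up to zeros their eigenvalues are the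
  roots of a real-rooted polynomial \<open>x\<^sup>4 - t x\<^sup>2 + q\<close>. The roots are \<open>\<plusminus>s\<^sub>1\<close>, \<open>\<plusminus>s\<^sub>2\<close> with
  \<open>(s\<^sub>1 + s\<^sub>2)\<^sup>2 = t + 2 \<surd>q\<close>, so the energy is \<open>2 \<surd>(t + 2 \<surd>q)\<close>. The bound \<open>q \<ge> 0\<close> for \<open>d = 7\<close> suffices
  for the comparison.
\<close>

section \<open>Certifying graph distances by a potential\<close>

text \<open>\<open>D\<close> is a certificate for the distance to \<open>v\<close>. By
  \<open>lip\<close> it drops by at most 1 along an arc, so no walk from \<open>u\<close> to
  \<open>v\<close> costs less than \<open>D u\<close>; by \<open>step\<close> every vertex other
  than \<open>v\<close> has an arc along which it drops by 1, and descending gives a walk of exactly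
  that cost.\<close>

lemma (in pair_graph) graph_dist_eqI:
  fixes D :: "'a \<Rightarrow> nat"
  assumes u: "u \<in> pverts G" and v: "D v = 0"
    and lip: "\<And>x y. (x, y) \<in> parcs G \<Longrightarrow> D x \<le> D y + 1"
    and step: "\<And>x. x \<in> pverts G \<Longrightarrow> x \<noteq> v \<Longrightarrow> \<exists>y. (x, y) \<in> parcs G \<and> D x = D y + 1"
  shows "graph_dist G u v = D u"
proof -
  have lower: "D x \<le> awalk_cost (\<lambda>_. 1) p" if "awalk x p v" for x p
    using that
  proof (induction p arbitrary: x)
    case Nil
    then show ?case using v by (simp add: awalk_Nil_iff)
  next
    case (Cons e p)
    then have "(x, snd e) \<in> parcs G" "awalk (snd e) p v"
      by (auto simp: awalk_Cons_iff)
    then have "D x \<le> D (snd e) + 1" "D (snd e) \<le> awalk_cost (\<lambda>_. 1) p"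
      using lip Cons.IH by auto
    then show ?case by simp
  qed
  have upper: "\<exists>p. awalk x p v \<and> awalk_cost (\<lambda>_. 1) p = D x" if "x \<in> pverts G" for x
    using that
  proof (induction "D x" arbitrary: x rule: less_induct)
    case less
    show ?case
    proof (cases "x = v")
      case True
      then show ?thesis using v less.prems by (intro exI[of _ "[]"]) (simp add: awalk_Nil_iff)
    next
      case False
      then obtain y where y: "(x, y) \<in> parcs G" "D x = D y + 1"
        using step less.prems by blast
      then have "y \<in> pverts G"
        using pair_wf_digraph.in_arcsD2 y(1) wellformed by force
      then obtain p where "awalk y p v" "awalk_cost (\<lambda>_. 1) p = D y"
        using less.hyps[of y] y by auto
      then show ?thesis
        using y by (intro exI[of _ "(x, y) # p"]) (auto simp: awalk_Cons_iff)
    qed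
  qed
  obtain p where p: "awalk u p v" "awalk_cost (\<lambda>_. 1) p = D u"
    using upper u by blast
  have "\<mu> (\<lambda>_. 1) u v = ereal (D u)"
  proof (rule antisym)
    show "\<mu> (\<lambda>_. 1) u v \<le> ereal (D u)"
      using min_cost_le_walk_cost[OF p(1), of "\<lambda>_. 1"] p(2) by simp
    show "ereal (D u) \<le> \<mu> (\<lambda>_. 1) u v"
      unfolding \<mu>_def using lower by (intro INF_greatest) auto
  qed
  then show ?thesis by (simp add: graph_dist_def)
qed

section \<open>Distances and eccentricities in the trees\<close>

text \<open>The projection of the tree onto its path. All indices above \<open>d + a\<close> go to
  the second centre, so \<open>b\<close> is not a parameter.\<close>

definition foot :: "nat \<Rightarrow> nat \<Rightarrow> nat \<Rightarrow> nat" where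
  "foot d a v = (if v \<le> d then v else if v \<le> d + a then (d - 1) div 2 else (d + 1) div 2)"

definition height :: "nat \<Rightarrow> nat \<Rightarrow> nat" where
  "height d v = (if v \<le> d then 0 else 1)"

text \<open>With truncated subtraction, \<open>(x - y) + (y - x)\<close> is the absolute difference
  of the feet. The case \<open>u = v\<close> is separate because the formula would give 2 at a
  pendant vertex.\<close>

definition tree_dist :: "nat \<Rightarrow> nat \<Rightarrow> nat \<Rightarrow> nat \<Rightarrow> nat" where
  "tree_dist d a u v = (if u = v then 0
     else (foot d a u - foot d a v) + (foot d a v - foot d a u) + height d u + height d v)"

lemma pverts_tree_T: "pverts (tree_T d a b) = {..<d + 1 + a + b}"
  by (simp add: tree_T_def Let_def)

lemma parcs_tree_T_iff:
  "(x, y) \<in> parcs (tree_T d a b) \<longleftrightarrow>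
    (x < d \<and> y = x + 1) \<or> (y < d \<and> x = y + 1)
    \<or> (d < y \<and> y \<le> d + a + b \<and> x = foot d a y) \<or> (d < x \<and> x \<le> d + a + b \<and> y = foot d a x)"
  by (auto simp: tree_T_def Let_def foot_def)

lemma foot_le: "1 \<le> d \<Longrightarrow> foot d a v \<le> d"
  by (auto simp: foot_def)

lemma foot_path [simp]: "v \<le> d \<Longrightarrow> foot d a v = v"
  by (simp add: foot_def)

lemma height_path [simp]: "v \<le> d \<Longrightarrow> height d v = 0"
  by (simp add: height_def)

lemma height_pendant [simp]: "d < v \<Longrightarrow> height d v = 1"
  by (simp add: height_def)

lemma graph_dist_tree_T:
  assumes d: "d \<ge> 1" and uv: "u < d + 1 + a + b" "v < d + 1 + a + b"
  shows "graph_dist (tree_T d a b) u v = tree_dist d a u v"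
proof -
  interpret pair_graph "tree_T d a b"
    using d by (rule pair_graph_tree_T)
  show ?thesis
  proof (rule graph_dist_eqI[where D = "\<lambda>x. tree_dist d a x v"])
    fix x y assume "(x, y) \<in> parcs (tree_T d a b)"
    then consider "x < d" "y = x + 1" | "y < d" "x = y + 1"
      | "d < y" "x = foot d a y" "x \<le> d" | "d < x" "y = foot d a x" "y \<le> d"
      unfolding parcs_tree_T_iff using foot_le[OF d] by blast
    then show "tree_dist d a x v \<le> tree_dist d a y v + 1"
      by cases (auto simp: tree_dist_def)
  next
    fix x assume x: "x \<in> pverts (tree_T d a b)" "x \<noteq> v"
    then have x': "x < d + 1 + a + b"
      by (simp add: pverts_tree_T)
    have f: "foot d a v \<le> d"
      using d by (rule foot_le)
    \<comment> \<open>The next vertex on a shortest path to \<open>v\<close>: a pendant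
      \<open>x\<close> drops to its foot, a path vertex moves towards the foot of \<open>v\<close>,
      and that foot itself steps to the pendant \<open>v\<close>.\<close>
    consider "d < x" | "x \<le> d" "foot d a v < x" | "x < foot d a v" | "x \<le> d" "foot d a v = x"
      by linarith
    then show "\<exists>y. (x, y) \<in> parcs (tree_T d a b) \<and> tree_dist d a x v = tree_dist d a y v + 1"
    proof cases
      case 1
      have "foot d a x \<le> d"
        using d by (rule foot_le)
      with 1 x x' show ?thesis
        by (intro exI[of _ "foot d a x"]) (auto simp: parcs_tree_T_iff tree_dist_def)
    next
      case 2
      with x x' show ?thesis
        by (intro exI[of _ "x - 1"]) (auto simp: parcs_tree_T_iff tree_dist_def)
    next
      case 3
      with f x show ?thesis
        by (intro exI[of _ "x + 1"]) (auto simp: parcs_tree_T_iff tree_dist_def)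
    next
      case 4
      with x have "d < v"
        by (intro ccontr[of "d < v"]) simp
      with 4 x uv show ?thesis
        by (intro exI[of _ v]) (auto simp: parcs_tree_T_iff tree_dist_def)
    qed
  qed (use uv in \<open>auto simp: pverts_tree_T tree_dist_def\<close>)
qed

definition tree_ecc :: "nat \<Rightarrow> nat \<Rightarrow> nat \<Rightarrow> nat" where
  "tree_ecc d a u = height d u + max (foot d a u) (d - foot d a u)"

text \<open>For \<open>d \<ge> 3\<close> pendant vertices hang at inner vertices of the path, so
  none is farther from \<open>u\<close> than the farther end of the path, \<open>0\<close> or
  \<open>d\<close>.\<close>

lemma eccentricity_tree_T:
  assumes d: "d \<ge> 3" "odd d" and u: "u < d + 1 + a + b"
  shows "eccentricity (tree_T d a b) u = tree_ecc d a u"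
proof -
  have "Max (tree_dist d a u ` {..<d + 1 + a + b}) = tree_ecc d a u"
  proof (rule Max_eqI)
    fix y assume "y \<in> tree_dist d a u ` {..<d + 1 + a + b}"
    then obtain v where y: "y = tree_dist d a u v" by auto
    have fv: "foot d a v \<le> d \<and> height d v = 0 \<or> height d v = 1 \<and> 1 \<le> foot d a v \<and> foot d a v + 1 \<le> d"
      using d by (auto simp: height_def foot_def)
    have "foot d a u \<le> d"
      using d by (intro foot_le) simp
    with fv show "y \<le> tree_ecc d a u"
      unfolding y tree_dist_def tree_ecc_def by (auto simp: max_def)
  next
    have fu: "foot d a u \<le> d"
      using d by (intro foot_le) simp
    show "tree_ecc d a u \<in> tree_dist d a u ` {..<d + 1 + a + b}"
    proof (cases "foot d a u \<le> d - foot d a u")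
      case True
      with fu have "tree_ecc d a u = tree_dist d a u d"
        using d by (auto simp: tree_ecc_def tree_dist_def)
      then show ?thesis using u by auto
    next
      case False
      with fu have "tree_ecc d a u = tree_dist d a u 0"
        by (auto simp: tree_ecc_def tree_dist_def)
      then show ?thesis using u by auto
    qed
  qed simp
  moreover have "graph_dist (tree_T d a b) u ` {..<d + 1 + a + b} = real ` tree_dist d a u ` {..<d + 1 + a + b}"
    using d u by (force simp: graph_dist_tree_T image_image)
  moreover have "Max (real ` tree_dist d a u ` {..<d + 1 + a + b}) = real (Max (tree_dist d a u ` {..<d + 1 + a + b}))"
    by (rule mono_Max_commute[symmetric]) (auto intro: monoI)
  ultimately show ?thesis
    by (simp add: eccentricity_def pverts_tree_T)
qed

lemma ecc_matrix_tree_T: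
  assumes d: "d \<ge> 3" "odd d"
  shows "ecc_matrix (tree_T d a b) = mat (d + 1 + a + b) (d + 1 + a + b) (\<lambda>(u, v).
     if tree_dist d a u v = min (tree_ecc d a u) (tree_ecc d a v) then real (tree_dist d a u v) else 0)"
proof -
  have "sorted_list_of_set (pverts (tree_T d a b)) = [0..<d + 1 + a + b]"
    by (simp add: pverts_tree_T lessThan_atLeast0 del: upt_Suc)
  then show ?thesis
    using d unfolding ecc_matrix_def Let_def
    by (intro eq_matI)
      (auto simp: ecc_entry_def graph_dist_tree_T eccentricity_tree_T of_nat_min[symmetric]
        simp del: upt_Suc of_nat_min)
qed


section \<open>Characteristic polynomials of \<open>A * B\<close> and \<open>B * A\<close>\<close>

text \<open>Evaluate the determinant of the block matrix \<open>N\<close> with rows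
  \<open>(X, A)\<close> and \<open>(B, 1)\<close> twice. Multiplication by \<open>L\<close> on the
  right, or by \<open>R\<close> on the left, clears the lower left block and leaves
  \<open>X - A * B\<close> or \<open>X - B * A\<close> on the diagonal; \<open>det L = 1\<close> and
  \<open>det R = X ^ m\<close>.\<close>

lemma char_poly_mult_commute:
  fixes A B :: "'a :: idom mat"
  assumes A: "A \<in> carrier_mat n m" and B: "B \<in> carrier_mat m n"
  shows "[:0, 1:] ^ m * char_poly (A * B) = [:0, 1:] ^ n * char_poly (B * A)"
proof -
  define X :: "'a poly" where "X = [:0, 1:]"
  define cA where "cA = map_mat (\<lambda>a. [:a:]) A"
  define cB where "cB = map_mat (\<lambda>a. [:a:]) B"
  have cA: "cA \<in> carrier_mat n m" and cB: "cB \<in> carrier_mat m n"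
    using A B by (auto simp: cA_def cB_def)
  interpret pc: comm_ring_hom "\<lambda>a :: 'a. [:a:]"
    by unfold_locales (auto simp: one_pCons)
  have AB: "map_mat (\<lambda>a. [:a:]) (A * B) = cA * cB"
    unfolding cA_def cB_def by (rule pc.mat_hom_mult[OF A B])
  have BA: "map_mat (\<lambda>a. [:a:]) (B * A) = cB * cA"
    unfolding cA_def cB_def by (rule pc.mat_hom_mult[OF B A])
  have char: "char_poly_matrix C = X \<cdot>\<^sub>m 1\<^sub>m k - map_mat (\<lambda>a. [:a:]) C"
    if "C \<in> carrier_mat k k" for C :: "'a mat" and k
    using that unfolding char_poly_matrix_def X_def by (intro eq_matI) auto
  have cAB: "char_poly_matrix (A * B) = X \<cdot>\<^sub>m 1\<^sub>m n - cA * cB"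
    using char[of "A * B" n] A B AB by simp
  have cBA: "char_poly_matrix (B * A) = X \<cdot>\<^sub>m 1\<^sub>m m - cB * cA"
    using char[of "B * A" m] A B BA by simp
  define N where "N = four_block_mat (X \<cdot>\<^sub>m 1\<^sub>m n) cA cB (1\<^sub>m m)"
  define L where "L = four_block_mat (1\<^sub>m n) (0\<^sub>m n m) (- cB) (1\<^sub>m m)"
  define R where "R = four_block_mat (1\<^sub>m n) (0\<^sub>m n m) (- cB) (X \<cdot>\<^sub>m 1\<^sub>m m)"
  have car: "N \<in> carrier_mat (n + m) (n + m)" "L \<in> carrier_mat (n + m) (n + m)"
    "R \<in> carrier_mat (n + m) (n + m)"
    using cA cB by (auto simp: N_def L_def R_def)
  have dN: "det N = char_poly (A * B)"
  proof -
    have "N * L = four_block_mat (X \<cdot>\<^sub>m 1\<^sub>m n - cA * cB) cA (0\<^sub>m m n) (1\<^sub>m m)"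
      unfolding N_def L_def
      using cA cB
      by (subst mult_four_block_mat[where ?n1.0 = n and ?n2.0 = m and ?nr1.0 = n and ?nr2.0 = m and ?nc1.0 = n and ?nc2.0 = m])
        (auto intro!: cong_four_block_mat)
    then have "det (N * L) = det (X \<cdot>\<^sub>m 1\<^sub>m n - cA * cB)"
      using cA cB by (simp only:) (subst det_four_block_mat_lower_left_zero[where n = n and m = m], auto)
    moreover have "det L = 1"
      using cA cB unfolding L_def
      by (subst det_four_block_mat_upper_right_zero[where n = n and m = m]) auto
    ultimately show ?thesis
      using det_mult[OF car(1,2)] by (simp add: char_poly_def cAB)
  qed
  have dR: "X ^ m * det N = X ^ n * char_poly (B * A)"
  proof -
    have "R * N = four_block_mat (X \<cdot>\<^sub>m 1\<^sub>m n) cA (0\<^sub>m m n) (X \<cdot>\<^sub>m 1\<^sub>m m - cB * cA)"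
      unfolding N_def R_def
      using cA cB
      by (subst mult_four_block_mat[where ?n1.0 = n and ?n2.0 = m and ?nr1.0 = n and ?nr2.0 = m and ?nc1.0 = n and ?nc2.0 = m])
        (auto intro!: cong_four_block_mat)
    then have "det (R * N) = X ^ n * det (X \<cdot>\<^sub>m 1\<^sub>m m - cB * cA)"
      using cA cB by (simp only:) (subst det_four_block_mat_lower_left_zero[where n = n and m = m], auto)
    moreover have "det R = X ^ m"
      using cA cB unfolding R_def
      by (subst det_four_block_mat_upper_right_zero[where n = n and m = m]) auto
    ultimately show ?thesis
      using det_mult[OF car(3,1)] by (simp add: char_poly_def cBA)
  qed
  show ?thesis
    using dR dN by (simp add: X_def)
qed

lemma det_mat_2:
  fixes f :: "nat \<times> nat \<Rightarrow> 'a :: comm_ring_1"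
  shows "det (mat 2 2 f) = f (0, 0) * f (1, 1) - f (0, 1) * f (1, 0)"
  by (subst laplace_expansion_row[where n = 2 and i = 0])
    (auto simp: numeral_2_eq_2 cofactor_def mat_delete_def det_single)

section \<open>Characteristic polynomial of the rank-four form\<close>

definition double_star_mat :: "nat \<Rightarrow> nat \<Rightarrow> nat \<Rightarrow> (nat \<Rightarrow> real) \<Rightarrow> (nat \<Rightarrow> real) \<Rightarrow> real mat" where
  "double_star_mat n i j u w = mat n n (\<lambda>(k, l). (if k = i then u l else 0) + (if l = i then u k else 0)
      + (if k = j then w l else 0) + (if l = j then w k else 0))"

text \<open>
  The matrix is \<open>A * B\<close> for the \<open>n \<times> 4\<close> matrix \<open>A\<close> with columns \<open>e\<^sub>i, e\<^sub>j, u, w\<close> and the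
  \<open>4 \<times> n\<close> matrix \<open>B\<close> with rows \<open>u, w, e\<^sub>i, e\<^sub>j\<close>. The orthogonality assumption makes the linear
  coefficient of the characteristic polynomial of \<open>B * A\<close> vanish.
\<close>

lemma char_poly_double_star:
  fixes u w :: "nat \<Rightarrow> real"
  assumes ij: "i < n" "j < n" "i \<noteq> j"
    and 0: "u i = 0" "w i = 0" "w j = 0"
    and orth: "u j * (\<Sum>k<n. u k * w k) = 0"
  shows "[:0, 1:] ^ 4 * char_poly (double_star_mat n i j u w) = [:0, 1:] ^ n *
    [:((\<Sum>k<n. (u k)\<^sup>2) - (u j)\<^sup>2) * (\<Sum>k<n. (w k)\<^sup>2) - (\<Sum>k<n. u k * w k)\<^sup>2, 0,
      - ((\<Sum>k<n. (u k)\<^sup>2) + (\<Sum>k<n. (w k)\<^sup>2)), 0, 1:]"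
proof -
  define U W S where "U = (\<Sum>k<n. (u k)\<^sup>2)" and "W = (\<Sum>k<n. (w k)\<^sup>2)" and "S = (\<Sum>k<n. u k * w k)"
  have S': "(\<Sum>k<n. w k * u k) = S"
    by (simp add: S_def mult.commute)
  define A where "A = mat n 4 (\<lambda>(k, l). if l = 0 then of_bool (k = i) else if l = 1 then of_bool (k = j)
    else if l = 2 then u k else w k)"
  define B where "B = mat 4 n (\<lambda>(l, k). if l = 0 then u k else if l = 1 then w k
    else if l = 2 then of_bool (k = i) else of_bool (k = j))"
  have A: "A \<in> carrier_mat n 4" and B: "B \<in> carrier_mat 4 n"
    by (auto simp: A_def B_def)
  have AB: "A * B = double_star_mat n i j u w"
    unfolding double_star_mat_def
    by (intro eq_matI) (auto simp: A_def B_def scalar_prod_def numeral_eq_Suc)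
  define X :: "real poly" where "X = [:0, 1:]"
  define P where "P = mat 2 2 (\<lambda>(k, l). if k = l then X else if k = 0 then [:- u j:] else 0)"
  define Q where "Q = mat 2 2 (\<lambda>(k, l). [:- (if k \<noteq> l then S else if k = 0 then U else W):])"
  define T where "T = mat 2 2 (\<lambda>(k, l). if k = l then X else if l = 0 then [:- u j:] else 0)"
  have car: "P \<in> carrier_mat 2 2" "Q \<in> carrier_mat 2 2" "T \<in> carrier_mat 2 2"
    by (auto simp: P_def Q_def T_def)
  have BA: "(B * A) $$ (k, l) = (if k = 0 then [0, u j, U, S] ! l else if k = 1 then [0, 0, S, W] ! l
     else if k = 2 then [1, 0, 0, 0] ! l else [0, 1, u j, 0] ! l)" if "k < 4" "l < 4" for k l
  proof -
    have "k \<in> {0, 1, 2, 3}" "l \<in> {0, 1, 2, 3}"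
      using that by auto
    then show ?thesis
      using ij 0
      by (auto simp: A_def B_def scalar_prod_def atLeast0LessThan S' U_def W_def S_def power2_eq_square
         of_bool_def if_distrib[of "\<lambda>x. x * _"] if_distrib[of "\<lambda>x. _ * x"] cong: if_cong)
  qed
  have "char_poly_matrix (B * A) = four_block_mat P Q (- 1\<^sub>m 2) T"
  proof (rule eq_matI)
    fix k l assume "k < dim_row (four_block_mat P Q (- 1\<^sub>m 2) T)" "l < dim_col (four_block_mat P Q (- 1\<^sub>m 2) T)"
    then have kl: "k < 4" "l < 4"
      using car by auto
    then have cases: "k = 0 \<or> k = 1 \<or> k = 2 \<or> k = 3" "l = 0 \<or> l = 1 \<or> l = 2 \<or> l = 3"
      by auto
    have entry: "char_poly_matrix (B * A) $$ (k, l) = (if k = l then X else 0) - [:(B * A) $$ (k, l):]"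
      using kl A B by (auto simp: char_poly_matrix_def X_def)
    show "char_poly_matrix (B * A) $$ (k, l) = four_block_mat P Q (- 1\<^sub>m 2) T $$ (k, l)"
      unfolding entry BA[OF kl] using cases
      by (elim disjE) (simp_all add: P_def Q_def T_def one_pCons)
  qed (use A B car in \<open>auto simp: char_poly_matrix_def\<close>)
  \<comment> \<open>The lower left block \<open>- 1\<close> commutes with \<open>T\<close>, so the 4
    by 4 determinant reduces to a 2 by 2 one.\<close>
  then have "char_poly (B * A) = det (P * T - Q * (- 1\<^sub>m 2))"
    unfolding char_poly_def
    using car by (simp add: det_four_block_mat[where n = 2])
  also have "P * T - Q * (- 1\<^sub>m 2) = P * T + Q"
    using car by (intro eq_matI) auto
  also have "P * T + Q = mat 2 2 (\<lambda>(k, l). if k = 0 then if l = 0 then X\<^sup>2 + [:(u j)\<^sup>2 - U:] else - Polynomial.smult (u j) X - [:S:]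
      else if l = 0 then - Polynomial.smult (u j) X - [:S:] else X\<^sup>2 - [:W:])"
    unfolding P_def T_def Q_def
    by (intro eq_matI) (auto simp: scalar_prod_def numeral_2_eq_2 less_Suc_eq X_def)
  \<comment> \<open>The linear coefficient is \<open>- 2 * u j * S\<close>, zero by
    \<open>orth\<close>; the two contributions of \<open>(u j)\<close> squared to the quadratic
    coefficient cancel.\<close>
  also have "det \<dots> = [:(U - (u j)\<^sup>2) * W - S\<^sup>2, 0, - (U + W), 0, 1:]"
    unfolding det_mat_2 X_def using orth[folded S_def]
    by (simp add: power2_eq_square algebra_simps)
  finally show ?thesis
    using char_poly_mult_commute[OF A B] by (simp add: AB U_def W_def S_def)
qed

section \<open>Energy from a biquadratic polynomial\<close>

text \<open>Zero roots have modulus 0, so the powers of \<open>[:0, 1:]\<close> on either side do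
  not affect the sum. The bounds on \<open>q\<close> and \<open>t\<close> make the other four roots
  real.\<close>

lemma sum_norm_proots_biquadratic:
  fixes M :: "real mat" and t q :: real
  assumes M: "M \<in> carrier_mat n n"
    and ch: "[:0, 1:] ^ k * char_poly M = [:0, 1:] ^ m * [:q, 0, - t, 0, 1:]"
    and q: "0 \<le> q" "2 * sqrt q \<le> t"
  shows "(\<Sum>x\<in>#proots (char_poly (map_mat complex_of_real M)). cmod x) = 2 * sqrt (t + 2 * sqrt q)"
proof -
  define r where "r = sqrt q"
  have r: "q = r\<^sup>2" "0 \<le> r" "2 * r \<le> t"
    using q by (auto simp: r_def)
  \<comment> \<open>Chosen so that the sum and the difference of \<open>s1\<close> and
    \<open>s2\<close> are the roots of \<open>t + 2 * r\<close> and \<open>t - 2 * r\<close>, which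
    avoids nested radicals.\<close>
  define s1 s2 where "s1 = (sqrt (t + 2 * r) + sqrt (t - 2 * r)) / 2"
    and "s2 = (sqrt (t + 2 * r) - sqrt (t - 2 * r)) / 2"
  have s: "s1 \<ge> 0" "s2 \<ge> 0" "s1 + s2 = sqrt (t + 2 * r)"
    using r by (auto simp: s1_def s2_def simp flip: add_divide_distrib)
  have s12: "s1 * s2 = r" "s1\<^sup>2 + s2\<^sup>2 = t"
    using r by (auto simp: s1_def s2_def field_simps power2_eq_square)
  define X :: "complex poly" where "X = [:0, 1:]"
  define c where "c = char_poly (map_mat complex_of_real M)"
  have hom: "c = map_poly of_real (char_poly M)"
    unfolding c_def by (rule of_real_hom.char_poly_hom[OF M])
  have q: "q = (s1 * s2)\<^sup>2"
    using r s12 by simp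
  interpret map_poly_hom: map_poly_comm_ring_hom complex_of_real ..
  have "X ^ k * c = map_poly of_real ([:0, 1:] ^ k * char_poly M)"
    by (simp add: hom X_def map_poly_hom.hom_mult map_poly_hom.hom_power)
  also have "\<dots> = X ^ m * [:of_real q, 0, - of_real t, 0, 1:]"
    unfolding ch by (simp add: X_def map_poly_hom.hom_mult map_poly_hom.hom_power del: mult_pCons_right)
  also have "[:of_real q, 0, - of_real t, 0, 1:] =
      [:of_real s1, 1:] * [:- of_real s1, 1:] * [:of_real s2, 1:] * [:- complex_of_real s2, 1:]"
    unfolding q s12(2)[symmetric] by (simp add: power2_eq_square algebra_simps)
  finally have eq: "X ^ k * c = X ^ m * ([:of_real s1, 1:] * [:- of_real s1, 1:] * [:of_real s2, 1:] * [:- of_real s2, 1:])" .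
  have "c \<noteq> 0"
    using eq by (auto simp: X_def simp del: mult_pCons_left mult_pCons_right)
  have "proots (X ^ k * c) = repeat_mset k {#0#} + proots c"
    using \<open>c \<noteq> 0\<close> by (subst proots_mult) (auto simp: X_def proots_power)
  moreover have "proots (X ^ m * ([:of_real s1, 1:] * [:- of_real s1, 1:] * [:of_real s2, 1:] * [:- of_real s2, 1:])) =
    repeat_mset m {#0#} + {#- of_real s1, of_real s1, - of_real s2, of_real s2#}"
    unfolding X_def
    by (simp add: proots_mult proots_power del: mult_pCons_left mult_pCons_right)
  ultimately have "(\<Sum>x\<in>#repeat_mset k {#0#} + proots c. cmod x) =
      (\<Sum>x\<in>#repeat_mset m {#0#} + {#- of_real s1, of_real s1, - of_real s2, of_real s2#}. cmod x)"
    using eq by simp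
  moreover have "(\<Sum>x\<in>#repeat_mset k {#0::complex#}. cmod x) = 0" for k
    by (induction k) auto
  ultimately show ?thesis
    using s by (simp add: c_def r_def)
qed


text \<open>The product form of \<open>orth\<close> covers both trees: \<open>u j = 0\<close> when
  the path has length 3, and \<open>u\<close>, \<open>w\<close> are orthogonal when it has length
  7.\<close>

lemma ecc_energy_double_star:
  fixes u w :: "nat \<Rightarrow> real"
  assumes M: "ecc_matrix G = double_star_mat n i j u w"
    and ij: "i < n" "j < n" "i \<noteq> j" "u i = 0" "w i = 0" "w j = 0"
    and orth: "u j * (\<Sum>k<n. u k * w k) = 0"
    and t: "t = (\<Sum>k<n. (u k)\<^sup>2) + (\<Sum>k<n. (w k)\<^sup>2)"
    and q: "q = ((\<Sum>k<n. (u k)\<^sup>2) - (u j)\<^sup>2) * (\<Sum>k<n. (w k)\<^sup>2) - (\<Sum>k<n. u k * w k)\<^sup>2"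
    and nonneg: "0 \<le> q" "2 * sqrt q \<le> t"
  shows "ecc_energy G = 2 * sqrt (t + 2 * sqrt q)"
  unfolding ecc_energy_def
proof (rule sum_norm_proots_biquadratic[OF _ _ nonneg])
  show "ecc_matrix G \<in> carrier_mat n n"
    by (simp add: M double_star_mat_def)
  show "[:0, 1:] ^ 4 * char_poly (ecc_matrix G) = [:0, 1:] ^ n * [:q, 0, - t, 0, 1:]"
    unfolding M q t using ij orth by (rule char_poly_double_star)
qed

section \<open>The energies of the two trees\<close>

text \<open>Used for the vectors of both trees, which are constant on each block of pendant
  vertices; only the path vertices are then summed explicitly.\<close>

lemma sum_two_constant_tails:
  fixes f :: "nat \<Rightarrow> real"
  assumes "\<And>k. N \<le> k \<Longrightarrow> k < N + a \<Longrightarrow> f k = x" "\<And>k. N + a \<le> k \<Longrightarrow> f k = y"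
  shows "(\<Sum>k<N + a + b. f k) = (\<Sum>k<N. f k) + a * x + b * y"
proof -
  have "(\<Sum>k<N + a + b. f k) = (\<Sum>k<N. f k) + (\<Sum>k=N..<N + a. f k) + (\<Sum>k=N + a..<N + a + b. f k)"
    by (simp add: lessThan_atLeast0 sum.atLeastLessThan_concat)
  then show ?thesis
    using assms by simp
qed

lemma ecc_energy_tree_T_3:
  "ecc_energy (tree_T 3 0 m) = 2 * sqrt (13 * real (m + 1) + 4 + 8 * sqrt (real (m + 1)))"
proof -
  \<comment> \<open>The number of leaves at vertex 2: the path end 3 and the \<open>m\<close>
    pendant vertices.\<close>
  define p where "p = real (m + 1)"
  have p: "p \<ge> 1"
    by (simp add: p_def)
  \<comment> \<open>The rows of the vertices 0 and 1.\<close>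
  define u w :: "nat \<Rightarrow> real" where "u k = (if k < 2 then 0 else if k = 2 then 2 else 3)"
    and "w k = (if k < 3 then 0 else 2)" for k
  have le3: "(3::nat) \<le> 3" "odd (3::nat)"
    by simp_all
  have M: "ecc_matrix (tree_T 3 0 m) = double_star_mat (4 + m) 0 1 u w"
    unfolding double_star_mat_def ecc_matrix_tree_T[OF le3]
  proof (rule cong_mat)
    fix k l :: nat
    have cases: "k = 0 \<or> k = 1 \<or> k = 2 \<or> k = 3 \<or> 4 \<le> k" "l = 0 \<or> l = 1 \<or> l = 2 \<or> l = 3 \<or> 4 \<le> l"
      by linarith+
    then have "(if tree_dist 3 0 k l = min (tree_ecc 3 0 k) (tree_ecc 3 0 l) then real (tree_dist 3 0 k l) else 0) =
        (if k = 0 then u l else 0) + (if l = 0 then u k else 0)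
          + (if k = 1 then w l else 0) + (if l = 1 then w k else 0)"
      by (elim disjE) (simp_all add: tree_dist_def tree_ecc_def foot_def height_def u_def w_def)
    then show "(case (k, l) of (u, v) \<Rightarrow> if tree_dist 3 0 u v = min (tree_ecc 3 0 u) (tree_ecc 3 0 v) then real (tree_dist 3 0 u v) else 0) =
        (case (k, l) of (k, l) \<Rightarrow> (if k = 0 then u l else 0) + (if l = 0 then u k else 0)
          + (if k = 1 then w l else 0) + (if l = 1 then w k else 0))"
      by (simp only: prod.case)
  qed simp_all
  have U: "(\<Sum>k<4 + m. (u k)\<^sup>2) = 4 + 9 * p"
    by (subst sum_two_constant_tails[where a = 0 and x = 9 and y = 9, unfolded add_0_right])
      (auto simp: u_def numeral_eq_Suc p_def)
  have W: "(\<Sum>k<4 + m. (w k)\<^sup>2) = 4 * p"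
    by (subst sum_two_constant_tails[where a = 0 and x = 4 and y = 4, unfolded add_0_right])
      (auto simp: w_def numeral_eq_Suc p_def)
  have S: "(\<Sum>k<4 + m. u k * w k) = 6 * p"
    by (subst sum_two_constant_tails[where a = 0 and x = 6 and y = 6, unfolded add_0_right])
      (auto simp: u_def w_def numeral_eq_Suc p_def)
  have root: "sqrt (16 * p) = 4 * sqrt p"
    by (simp add: real_sqrt_mult)
  \<comment> \<open>Gives the bound \<open>2 * sqrt q \<le> t\<close>, here
    \<open>8 * sqrt p \<le> 13 * p + 4\<close>.\<close>
  have "sqrt p \<le> p"
    using p by (intro real_le_lsqrt) (auto simp: power2_eq_square)
  then have "ecc_energy (tree_T 3 0 m) = 2 * sqrt (13 * p + 4 + 2 * sqrt (16 * p))"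
    using p by (intro ecc_energy_double_star[OF M])
      (simp_all add: U W S root, simp_all add: u_def w_def power2_eq_square algebra_simps)
  then show ?thesis
    unfolding root by (simp add: p_def)
qed

lemma ecc_energy_tree_T_7:
  "ecc_energy (tree_T 7 a b) =
    2 * sqrt (203 + 25 * real (a + b) + 2 * sqrt ((77 + 25 * real a) * (77 + 25 * real b)))"
proof -
  \<comment> \<open>The rows of the path ends 0 and 7, except that their common entry 7 is put into
    \<open>u\<close> alone so that it is not counted twice. This makes the supports
    disjoint.\<close>
  define u w :: "nat \<Rightarrow> real" where "u k = (if k < 4 then 0 else if k < 8 then real k else if k < 8 + a then 0 else 5)"
    and "w k = (if k = 0 then 0 else if k < 4 then 7 - real k else if k < 8 then 0 else if k < 8 + a then 5 else 0)" for k
  have le7: "(3::nat) \<le> 7" "odd (7::nat)"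
    by simp_all
  have M: "ecc_matrix (tree_T 7 a b) = double_star_mat (8 + a + b) 0 7 u w"
    unfolding double_star_mat_def ecc_matrix_tree_T[OF le7]
  proof (rule cong_mat)
    fix k l :: nat
    have cases: "k = 0 \<or> k = 1 \<or> k = 2 \<or> k = 3 \<or> k = 4 \<or> k = 5 \<or> k = 6 \<or> k = 7 \<or> 8 \<le> k \<and> k < 8 + a \<or> 8 + a \<le> k"
      "l = 0 \<or> l = 1 \<or> l = 2 \<or> l = 3 \<or> l = 4 \<or> l = 5 \<or> l = 6 \<or> l = 7 \<or> 8 \<le> l \<and> l < 8 + a \<or> 8 + a \<le> l"
      by linarith+
    then have "(if tree_dist 7 a k l = min (tree_ecc 7 a k) (tree_ecc 7 a l) then real (tree_dist 7 a k l) else 0) =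
        (if k = 0 then u l else 0) + (if l = 0 then u k else 0)
          + (if k = 7 then w l else 0) + (if l = 7 then w k else 0)"
      by (elim disjE) (simp_all add: tree_dist_def tree_ecc_def foot_def height_def u_def w_def)
    then show "(case (k, l) of (u, v) \<Rightarrow> if tree_dist 7 a u v = min (tree_ecc 7 a u) (tree_ecc 7 a v) then real (tree_dist 7 a u v) else 0) =
        (case (k, l) of (k, l) \<Rightarrow> (if k = 0 then u l else 0) + (if l = 0 then u k else 0)
          + (if k = 7 then w l else 0) + (if l = 7 then w k else 0))"
      by (simp only: prod.case)
  qed simp_all
  have U: "(\<Sum>k<8 + a + b. (u k)\<^sup>2) = 126 + 25 * real b"
    by (subst sum_two_constant_tails[where x = 0 and y = 25]) (auto simp: u_def eval_nat_numeral)
  have W: "(\<Sum>k<8 + a + b. (w k)\<^sup>2) = 77 + 25 * real a"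
    by (subst sum_two_constant_tails[where x = 25 and y = 0]) (auto simp: w_def eval_nat_numeral)
  have S: "(\<Sum>k<8 + a + b. u k * w k) = 0"
    by (rule sum.neutral) (auto simp: u_def w_def)
  \<comment> \<open>The arithmetic-geometric mean inequality for the two factors of
    \<open>q\<close>; \<open>t\<close> exceeds their sum by 49, the square of
    \<open>u 7\<close>.\<close>
  have "2 * sqrt ((77 + 25 * real a) * (77 + 25 * real b)) \<le> (77 + 25 * real a) + (77 + 25 * real b)"
    using arith_geo_mean_sqrt[of "77 + 25 * real a" "77 + 25 * real b"] by simp
  then show ?thesis
    by (intro ecc_energy_double_star[OF M])
      (simp_all add: U W S, simp_all add: u_def w_def algebra_simps)
qed

section \<open>Comparison of the energies\<close>

theorem theorem4p5:
  fixes n a b :: nat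
  assumes "a \<ge> 1" and "b \<ge> a" and "a + b + 8 = n"
  shows "ecc_energy (tree_T 7 a b) > ecc_energy (tree_T 3 0 (n - 4))"
proof -
  define s where "s = real (a + b)"
  have n: "real (n - 4 + 1) = s + 5"
    using assms by (simp add: s_def)
  have s: "s \<ge> 0"
    by (simp add: s_def)
  \<comment> \<open>The tangent to the square root at 4, evaluated at \<open>s + 5\<close>. It
    bounds the left-hand radicand below by \<open>15 * s + 87\<close> from above, leaving ample room
    under \<open>203 + 25 * s\<close>.\<close>
  then have "sqrt (s + 5) \<le> (s + 9) / 4"
    by (intro real_le_lsqrt) (auto simp: power2_eq_square field_simps)
  then have "13 * (s + 5) + 4 + 8 * sqrt (s + 5) < 203 + 25 * s"
    using s by simp
  also have "\<dots> \<le> 203 + 25 * s + 2 * sqrt ((77 + 25 * real a) * (77 + 25 * real b))"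
    by simp
  finally show ?thesis
    unfolding ecc_energy_tree_T_3 ecc_energy_tree_T_7 n s_def by simp
qed

end
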